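(* For every positive integer $n$ and every tree $T$ with $n$ vertices, $\mathrm{avi}(S_n)\ge \mathrm{avi}(T)$, where $S_n$ is the star with $n$ vertices.
   Context: All graphs are finite and simple. For a graph $G$, an independent set is a set of pairwise non-adjacent vertices (the empty set is independent). $\mathrm{avi}(G)$ denotes the average size of independent sets of $G$: $\mathrm{avi}(G)=\mathrm{T}(G)/\mathrm{I}(G)$, where $\mathrm{I}(G)$ is the number of independent sets of $G$ and $\mathrm{T}(G)$ is the sum of the cardinalities of all independent sets of $G$. The $n$-vertex star $S_n$ consists of one centre vertex adjacent to each of the $n-1$ other vertices, with no other edges. *)

theory Defs
  imports Complex_Main "Graph_Theory.Graph_Theory"
begin

text \<open>
  Simple graphs are symmetric, loop-free digraphs without parallel arcs, i.e. instances of the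
  locale \<^locale>\<open>graph\<close>; each undirected edge is represented by its two orientations.
  With this representation the library predicate \<^const>\<open>tree\<close> is unsuitable: running along an
  edge and back is a \<^const>\<open>pre_digraph.cycle\<close>, so a symmetric digraph with an edge is never
  a \<^const>\<open>tree\<close>. The cycles of the undirected graph are those of length at least 3.
\<close>

definition undirected_tree :: "('a, 'b) pre_digraph \<Rightarrow> bool" where
  "undirected_tree G \<longleftrightarrow>
     graph G \<and> connected G \<and> \<not> (\<exists>p. pre_digraph.cycle G p \<and> 3 \<le> length p)"

definition star :: "nat \<Rightarrow> (nat, nat \<times> nat) pre_digraph" where
  "star n = \<lparr>verts = {..<n}, arcs = {0} \<times> {1..<n} \<union> {1..<n} \<times> {0}, tail = fst, head = snd\<rparr>"

definition independent_sets :: "('a, 'b) pre_digraph \<Rightarrow> 'a set set" where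
  "independent_sets G = {S. S \<subseteq> verts G \<and> pairwise (\<lambda>u v. \<not> u \<rightarrow>\<^bsub>G\<^esub> v) S}"

definition num_independent_sets :: "('a, 'b) pre_digraph \<Rightarrow> nat" where
  "num_independent_sets G = card (independent_sets G)"

definition total_independent_size :: "('a, 'b) pre_digraph \<Rightarrow> nat" where
  "total_independent_size G = (\<Sum>S\<in>independent_sets G. card S)"

definition avi :: "('a, 'b) pre_digraph \<Rightarrow> real" where
  "avi G = real (total_independent_size G) / real (num_independent_sets G)"

end

theory Submission
  imports Defs
begin

text \<open>
  Write \<open>N(S)\<close> for the set of neighbours of an independent set \<open>S\<close>. Deleting \<open>v\<close> is a bijection
  from the independent sets that contain \<open>v\<close> onto those that contain neither \<open>v\<close> nor a
  neighbour of \<open>v\<close>. Double counting over \<open>v\<close> then gives \<open>n I(G) = 2 T(G) + \<Sum>\<^sub>S |N(S)|\<close>.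
  If \<open>G\<close> is connected and \<open>n \<ge> 2\<close>, every nonempty \<open>S\<close> has \<open>|N(S)| \<ge> 1\<close>, and the singletons
  together contribute the sum of the degrees, which is at least \<open>2(n - 1)\<close>; hence
  \<open>2 T(G) \<le> (n - 1) I(G) - (n - 3)\<close>, with equality for the star. Dividing by \<open>I(G)\<close> and using
  \<open>I(G) \<le> 2\<^sup>n\<^sup>-\<^sup>1 + 1 = I(S\<^sub>n)\<close> (for \<open>n \<ge> 3\<close>) gives the result.
\<close>

text \<open>Complementation pairs \<open>S\<close> with \<open>A - S\<close>, and the two sizes add
  up to \<open>card A\<close>. Applied to the leaves of the star.\<close>

lemma two_sum_card_Pow:
  assumes "finite A"
  shows "2 * (\<Sum>S\<in>Pow A. card S) = card A * 2 ^ card A"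
proof -
  have "(\<Sum>S\<in>Pow A. card S) = (\<Sum>S\<in>Pow A. card (A - S))"
    by (rule sum.reindex_bij_witness[of _ "\<lambda>S. A - S" "\<lambda>S. A - S"])
      (auto simp: double_diff)
  then have "2 * (\<Sum>S\<in>Pow A. card S) = (\<Sum>S\<in>Pow A. card S + card (A - S))"
    by (simp add: sum.distrib)
  also have "\<dots> = (\<Sum>S\<in>Pow A. card A)"
    using assms
    by (intro sum.cong refl) (auto simp: card_Diff_subset finite_subset card_mono)
  finally show ?thesis
    using assms by (simp add: card_Pow)
qed

section \<open>Double counting neighbourhoods of independent sets\<close>

context graph
begin

lemma dominates_sym: "u \<rightarrow> v \<longleftrightarrow> v \<rightarrow> u"
  using arcs_ends_symmetric[OF sym_arcs] by blast

lemma not_dominates_refl: "\<not> u \<rightarrow> u"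
  using adj_not_same by blast

lemma independent_sets_eq:
  "independent_sets G = {S. S \<subseteq> verts G \<and> (\<forall>u\<in>S. \<forall>v\<in>S. \<not> u \<rightarrow> v)}"
proof -
  have "pairwise (\<lambda>u v. \<not> u \<rightarrow> v) S \<longleftrightarrow> (\<forall>u\<in>S. \<forall>v\<in>S. \<not> u \<rightarrow> v)" for S
    using not_dominates_refl unfolding pairwise_def by metis
  then show ?thesis
    by (simp add: independent_sets_def)
qed

lemma finite_independent_sets [simp]: "finite (independent_sets G)"
  by (rule finite_subset[of _ "Pow (verts G)"]) (auto simp: independent_sets_def)

lemma neighbours_subset_verts: "arcs_ends G `` S \<subseteq> verts G"
  using adj_in_verts by blast

lemma finite_neighbours [simp]: "finite (arcs_ends G `` S)"
  using neighbours_subset_verts finite_verts finite_subset by metis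

lemma finite_arcs_ends [simp]: "finite (arcs_ends G)"
  by (simp add: arcs_ends_def)

lemma card_independent_sets_not_containing:
  assumes v: "v \<in> verts G"
  shows "card {S \<in> independent_sets G. v \<notin> S} =
    card {S \<in> independent_sets G. v \<in> S} + card {S \<in> independent_sets G. v \<in> arcs_ends G `` S}"
proof -
  \<comment> \<open>\<open>?A\<close> collects the sets that stay independent when \<open>v\<close>
    is inserted; in \<open>?B\<close> a neighbour of \<open>v\<close> blocks this.\<close>
  let ?A = "{S \<in> independent_sets G. v \<notin> S \<and> v \<notin> arcs_ends G `` S}"
  let ?B = "{S \<in> independent_sets G. v \<in> arcs_ends G `` S}"
  have "bij_betw (insert v) ?A {S \<in> independent_sets G. v \<in> S}"
  proof (rule bij_betw_byWitness[where f' = "\<lambda>S. S - {v}"])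
    show "insert v ` ?A \<subseteq> {S \<in> independent_sets G. v \<in> S}"
      using v dominates_sym not_dominates_refl by (auto simp: independent_sets_eq)
  qed (auto simp: independent_sets_eq)
  then have "card ?A = card {S \<in> independent_sets G. v \<in> S}"
    by (rule bij_betw_same_card)
  moreover have "{S \<in> independent_sets G. v \<notin> S} = ?A \<union> ?B"
    by (auto simp: independent_sets_eq)
  moreover have "card (?A \<union> ?B) = card ?A + card ?B"
    by (rule card_Un_disjoint) auto
  ultimately show ?thesis
    by simp
qed

lemma total_independent_size_add_neighbours:
  "2 * total_independent_size G + (\<Sum>S\<in>independent_sets G. card (arcs_ends G `` S)) =
    card (verts G) * num_independent_sets G"
proof -
  \<comment> \<open>Counts pairs \<open>(S, v)\<close> with \<open>v \<in> F S\<close> in two ways;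
    needed both for the identity and for the neighbourhood map as \<open>F\<close>.\<close>
  have swap: "(\<Sum>S\<in>independent_sets G. card (F S)) =
      (\<Sum>v\<in>verts G. card {S \<in> independent_sets G. v \<in> F S})"
    if "\<And>S. S \<in> independent_sets G \<Longrightarrow> F S \<subseteq> verts G" for F :: "'a set \<Rightarrow> 'a set"
  proof -
    have "(\<Sum>S\<in>independent_sets G. card (F S)) =
        (\<Sum>S\<in>independent_sets G. card {v \<in> verts G. v \<in> F S})"
      using that by (intro sum.cong refl arg_cong[where f = card]) auto
    also have "\<dots> = (\<Sum>v\<in>verts G. card {S \<in> independent_sets G. v \<in> F S})"
      by (rule sum_multicount_gen) auto
    finally show ?thesis .
  qed
  have T: "total_independent_size G = (\<Sum>v\<in>verts G. card {S \<in> independent_sets G. v \<in> S})"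
    unfolding total_independent_size_def
    by (rule swap) (auto simp: independent_sets_def)
  have N: "(\<Sum>S\<in>independent_sets G. card (arcs_ends G `` S)) =
      (\<Sum>v\<in>verts G. card {S \<in> independent_sets G. v \<in> arcs_ends G `` S})"
    by (rule swap) (rule neighbours_subset_verts)
  have "num_independent_sets G =
      card {S \<in> independent_sets G. v \<in> S} + card {S \<in> independent_sets G. v \<notin> S}" for v
    unfolding num_independent_sets_def
    by (subst card_Un_disjoint[symmetric]) (auto intro!: arg_cong[where f = card])
  then have "(\<Sum>v\<in>verts G. num_independent_sets G) =
      (\<Sum>v\<in>verts G. card {S \<in> independent_sets G. v \<in> S} + card {S \<in> independent_sets G. v \<notin> S})"
    by (intro sum.cong refl)
  then have "card (verts G) * num_independent_sets G =
      (\<Sum>v\<in>verts G. card {S \<in> independent_sets G. v \<in> S} + card {S \<in> independent_sets G. v \<notin> S})"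
    by simp
  also have "\<dots> = (\<Sum>v\<in>verts G. 2 * card {S \<in> independent_sets G. v \<in> S} +
      card {S \<in> independent_sets G. v \<in> arcs_ends G `` S})"
    by (intro sum.cong refl) (simp add: card_independent_sets_not_containing)
  finally show ?thesis
    by (simp only: T N sum.distrib sum_distrib_left)
qed

section \<open>Consequences of connectedness\<close>

text \<open>Connectedness as an induction principle: symmetry of the arcs turns it into directed
  reachability from \<open>r\<close>, and membership in \<open>X\<close> spreads along
  paths.\<close>

lemma verts_subset_closedI:
  assumes "connected G" "r \<in> verts G" "r \<in> X"
    and closed: "\<And>u v. u \<rightarrow> v \<Longrightarrow> u \<in> X \<Longrightarrow> v \<in> X"
  shows "verts G \<subseteq> X"
proof
  fix v assume "v \<in> verts G"
  moreover have "strongly_connected G"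
    using symmetric_connected_imp_strongly_connected sym_arcs assms(1) by blast
  ultimately have "r \<rightarrow>\<^sup>* v"
    using assms(2) by (auto simp: strongly_connected_def)
  then show "v \<in> X"
    by (induction rule: reachable_induct) (use assms in auto)
qed

text \<open>A vertex set \<open>W\<close> is grown one vertex at a time, each new vertex bringing an
  edge in both orientations. In undirected terms there are at least n - 1 edges.\<close>

lemma card_arcs_ends_ge:
  assumes "connected G"
  shows "2 * card (verts G) \<le> card (arcs_ends G) + 2"
proof -
  have "\<exists>W\<subseteq>verts G. card W = Suc k \<and> 2 * k \<le> card (arcs_ends G \<inter> W \<times> W)"
    if "k < card (verts G)" for k
    using that
  proof (induction k)
    case 0
    then obtain r where "r \<in> verts G"
      by fastforce
    then show ?case
      by (intro exI[of _ "{r}"]) auto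
  next
    case (Suc k)
    then obtain W where W: "W \<subseteq> verts G" "card W = Suc k"
        "2 * k \<le> card (arcs_ends G \<inter> W \<times> W)"
      by auto
    then obtain r where "r \<in> W"
      by fastforce
    moreover have "\<not> verts G \<subseteq> W"
      using W Suc.prems by auto
    \<comment> \<open>A nonempty proper subset of the vertices is not closed under adjacency, so
      some arc leaves it.\<close>
    ultimately obtain u v where uv: "u \<rightarrow> v" "u \<in> W" "v \<notin> W"
      using verts_subset_closedI[OF assms, of r W] W(1) by blast
    have fin: "finite W"
      using W finite_subset finite_verts by blast
    let ?W = "insert v W"
    have "card (insert (u, v) (insert (v, u) (arcs_ends G \<inter> W \<times> W))) =
        2 + card (arcs_ends G \<inter> W \<times> W)"
      using uv by (subst card_insert_disjoint; auto)+
    moreover have "card (insert (u, v) (insert (v, u) (arcs_ends G \<inter> W \<times> W))) \<le>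
        card (arcs_ends G \<inter> ?W \<times> ?W)"
      using uv dominates_sym by (intro card_mono) auto
    ultimately show ?case
      using W uv fin adj_in_verts by (intro exI[of _ ?W]) auto
  qed
  moreover have "card (verts G) - 1 < card (verts G)"
    using assms by (simp add: connected_def strongly_connected_def card_gt_0_iff mk_symmetric_def)
  ultimately obtain W where "2 * (card (verts G) - 1) \<le> card (arcs_ends G \<inter> W \<times> W)"
    by blast
  also have "\<dots> \<le> card (arcs_ends G)"
    by (intro card_mono) auto
  finally show ?thesis
    by simp
qed

text \<open>Arcs are grouped by tail. The usual factor 2 is absent because
  \<open>arcs_ends G\<close> holds both orientations of each edge.\<close>

lemma sum_degrees: "(\<Sum>v\<in>verts G. card (arcs_ends G `` {v})) = card (arcs_ends G)"
proof -
  have "card (arcs_ends G) = card (Sigma (verts G) (\<lambda>v. arcs_ends G `` {v}))"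
    using adj_in_verts by (intro arg_cong[where f = card]) auto
  then show ?thesis
    by simp
qed

lemma neighbours_nonempty:
  assumes "connected G" "u \<in> verts G" "w \<in> verts G" "u \<noteq> w"
  shows "arcs_ends G `` {u} \<noteq> {}"
  using verts_subset_closedI[of u "{u}"] assms by blast

lemma singleton_independent: "v \<in> verts G \<Longrightarrow> {v} \<in> independent_sets G"
  by (simp add: independent_sets_eq not_dominates_refl)

text \<open>The empty set and the singletons already give this many. For one or two vertices the
  bound meets the upper bound below, which settles these orders in the theorem.\<close>

lemma num_independent_sets_ge: "card (verts G) + 1 \<le> num_independent_sets G"
proof -
  have "card (insert {} ((\<lambda>v. {v}) ` verts G)) \<le> card (independent_sets G)"
    using singleton_independent by (intro card_mono) (auto simp: independent_sets_eq)
  moreover have "card (insert {} ((\<lambda>v. {v}) ` verts G)) = card (verts G) + 1"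
    by (subst card_insert_disjoint) (auto simp: card_image)
  ultimately show ?thesis
    by (simp add: num_independent_sets_def)
qed

text \<open>The empty set contributes 0, the singletons at least 2n - 2, and each of the other I - n
  - 1 sets at least 1: in total at least I + n - 3.\<close>

lemma sum_card_neighbours_ge:
  assumes "connected G"
  shows "num_independent_sets G + card (verts G) \<le>
    (\<Sum>S\<in>independent_sets G. card (arcs_ends G `` S)) + 3"
proof -
  let ?d = "\<lambda>S. card (arcs_ends G `` S)"
  let ?L = "(\<lambda>v. {v}) ` verts G"
  define R where "R = independent_sets G - insert {} ?L"
  have I: "independent_sets G = insert {} ?L \<union> R"
    using singleton_independent by (auto simp: R_def independent_sets_eq)
  have fin: "finite R" and disj: "insert {} ?L \<inter> R = {}"
    by (auto simp: R_def)
  have "num_independent_sets G = card (insert {} ?L) + card R"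
    unfolding num_independent_sets_def I by (rule card_Un_disjoint) (use fin disj in auto)
  moreover have "card (insert {} ?L) = card (verts G) + 1"
    by (subst card_insert_disjoint) (auto simp: card_image)
  moreover have "(\<Sum>S\<in>independent_sets G. ?d S) = (\<Sum>S\<in>insert {} ?L. ?d S) + (\<Sum>S\<in>R. ?d S)"
    unfolding I by (rule sum.union_disjoint) (use fin disj in auto)
  moreover have "(\<Sum>S\<in>insert {} ?L. ?d S) = card (arcs_ends G)"
    by (subst sum.insert) (auto simp: sum.reindex sum_degrees)
  moreover have "card R \<le> (\<Sum>S\<in>R. ?d S)"
  proof -
    have "1 \<le> ?d S" if "S \<in> R" for S
    proof -
      \<comment> \<open>A member of \<open>R\<close> has two distinct vertices; the second one
        ensures that the first is not isolated.\<close>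
      have S: "S \<subseteq> verts G" "S \<noteq> {}" "\<And>v. v \<in> verts G \<Longrightarrow> S \<noteq> {v}"
        using that by (auto simp: R_def independent_sets_def)
      then obtain u w where "u \<in> S" "w \<in> S" "u \<noteq> w"
        by blast
      then have "arcs_ends G `` S \<noteq> {}"
        using neighbours_nonempty[OF assms, of u w] S(1) by blast
      then show ?thesis
        by (simp add: Suc_le_eq card_gt_0_iff)
    qed
    then have "(\<Sum>S\<in>R. 1) \<le> (\<Sum>S\<in>R. ?d S)"
      by (rule sum_mono)
    then show ?thesis
      by simp
  qed
  ultimately show ?thesis
    using card_arcs_ends_ge[OF assms] by linarith
qed

text \<open>
  Replacing the independent sets that contain \<open>r\<close> by their complements maps all independent
  sets to subsets of \<open>V - {r}\<close>. Two of them collide only if they form a bipartition of \<open>G\<close>,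
  and a connected graph has at most one.
\<close>

lemma num_independent_sets_le:
  assumes "connected G"
  shows "num_independent_sets G \<le> 2 ^ (card (verts G) - 1) + 1"
proof -
  obtain r where r: "r \<in> verts G"
    using assms by (auto simp: connected_def strongly_connected_def mk_symmetric_def)
  define A where "A = {S \<in> independent_sets G. r \<notin> S}"
  define B where "B = (\<lambda>S. verts G - S) ` {S \<in> independent_sets G. r \<in> S}"
  have inj: "inj_on (\<lambda>S. verts G - S) {S \<in> independent_sets G. r \<in> S}"
    by (rule inj_on_inverseI[where g = "\<lambda>S. verts G - S"])
      (auto simp: independent_sets_def)
  have fin: "finite A" "finite B"
    by (auto simp: A_def B_def)
  have "num_independent_sets G = card A + card {S \<in> independent_sets G. r \<in> S}"
    unfolding num_independent_sets_def A_def
    by (subst card_Un_disjoint[symmetric]) (auto intro!: arg_cong[where f = card])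
  also have "\<dots> = card A + card B"
    by (simp add: B_def card_image[OF inj])
  also have "\<dots> = card (A \<union> B) + card (A \<inter> B)"
    by (rule card_Un_Int) (use fin in auto)
  also have "card (A \<union> B) \<le> card (Pow (verts G - {r}))"
    by (intro card_mono) (auto simp: A_def B_def independent_sets_def)
  also have "card (Pow (verts G - {r})) = 2 ^ (card (verts G) - 1)"
    using r by (simp add: card_Pow)
  also have "card (A \<inter> B) \<le> 1"
  proof -
    \<comment> \<open>Both \<open>X\<close> and its complement are independent, so every arc crosses
      between them.\<close>
    have flip: "v \<in> X \<longleftrightarrow> u \<notin> X" if "X \<in> A \<inter> B" "u \<rightarrow> v" for X u v
    proof -
      obtain S where S: "S \<in> independent_sets G" "X = verts G - S"
        using \<open>X \<in> A \<inter> B\<close> by (auto simp: B_def)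
      have "X \<in> independent_sets G"
        using \<open>X \<in> A \<inter> B\<close> by (auto simp: A_def)
      then show ?thesis
        using S \<open>u \<rightarrow> v\<close> adj_in_verts[OF \<open>u \<rightarrow> v\<close>] by (auto simp: independent_sets_eq)
    qed
    have "X = Y" if X: "X \<in> A \<inter> B" and Y: "Y \<in> A \<inter> B" for X Y
    proof -
      \<comment> \<open>\<open>X\<close> and \<open>Y\<close> both miss \<open>r\<close>, and
        membership in each flips along every arc, so agreement spreads from \<open>r\<close> to all
        vertices.\<close>
      have "verts G \<subseteq> {v. v \<in> X \<longleftrightarrow> v \<in> Y}"
      proof (rule verts_subset_closedI[OF assms r])
        show "r \<in> {v. v \<in> X \<longleftrightarrow> v \<in> Y}"
          using X Y by (auto simp: A_def)
      qed (use flip[OF X] flip[OF Y] in auto)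
      then show ?thesis
        using X Y by (auto simp: A_def independent_sets_def)
    qed
    then show ?thesis
      using fin by (simp add: card_le_Suc0_iff_eq)
  qed
  finally show ?thesis
    by simp
qed

end

section \<open>Independent sets of the star\<close>

lemma arcs_ends_star: "arcs_ends (star n) = {0} \<times> {1..<n} \<union> {1..<n} \<times> {0}"
  by (auto simp: arcs_ends_conv star_def)

text \<open>The centre 0 excludes every leaf, while leaves never exclude each other.\<close>

lemma independent_sets_star:
  assumes "n > 0"
  shows "independent_sets (star n) = insert {0} (Pow {1..<n})"
proof (intro equalityI subsetI)
  fix S assume S: "S \<in> independent_sets (star n)"
  then have sub: "S \<subseteq> {..<n}"
    by (auto simp: independent_sets_def star_def)
  show "S \<in> insert {0} (Pow {1..<n})"
  proof (cases "0 \<in> S")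
    case True
    have "v = 0" if "v \<in> S" for v
    proof (rule ccontr)
      assume "v \<noteq> 0"
      then have "(0, v) \<in> arcs_ends (star n)"
        using sub that by (auto simp: arcs_ends_star)
      then show False
        using S True that \<open>v \<noteq> 0\<close> by (auto simp: independent_sets_def pairwise_def)
    qed
    then show ?thesis
      using True by auto
  next
    case False
    then show ?thesis
      using sub by (auto simp: Suc_le_eq intro: gr0I)
  qed
next
  fix S assume "S \<in> insert {0} (Pow {1..<n})"
  moreover have "verts (star n) = {..<n}"
    by (simp add: star_def)
  ultimately show "S \<in> independent_sets (star n)"
    using assms by (auto simp: independent_sets_def pairwise_def arcs_ends_star)
qed

lemma num_independent_sets_star:
  assumes "n > 0"
  shows "num_independent_sets (star n) = 2 ^ (n - 1) + 1"
  unfolding num_independent_sets_def independent_sets_star[OF assms]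
  by (subst card_insert_disjoint) (auto simp: card_Pow)

text \<open>The summand 2 is the doubled size of \<open>{0}\<close>; the rest comes from the sets of
  leaves.\<close>

lemma total_independent_size_star:
  assumes "n > 0"
  shows "2 * total_independent_size (star n) = (n - 1) * 2 ^ (n - 1) + 2"
proof -
  have "total_independent_size (star n) = 1 + (\<Sum>S\<in>Pow {1..<n}. card S)"
    unfolding total_independent_size_def independent_sets_star[OF assms]
    by (subst sum.insert) auto
  then show ?thesis
    using two_sum_card_Pow[of "{1..<n}"] by simp
qed

section \<open>Comparison of the two averages\<close>

theorem theorem4p1:
  fixes n :: nat and T :: "('a, 'b) pre_digraph"
  assumes "n > 0"
    and "undirected_tree T"
    and "card (verts T) = n"
  shows "avi (star n) \<ge> avi T"
proof -
  interpret graph T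
    using assms(2) by (simp add: undirected_tree_def)
  have con: "connected T"
    using assms(2) by (simp add: undirected_tree_def)
  define i t where "i = real (num_independent_sets T)" and "t = real (total_independent_size T)"
  define i' t' where "i' = real (num_independent_sets (star n))"
    and "t' = real (total_independent_size (star n))"
  have "2 * total_independent_size T + num_independent_sets T + n \<le> n * num_independent_sets T + 3"
    using total_independent_size_add_neighbours sum_card_neighbours_ge[OF con] assms(3) by simp
  then have "real (2 * total_independent_size T + num_independent_sets T + n)
      \<le> real (n * num_independent_sets T + 3)"
    by (simp only: of_nat_le_iff)
  then have t: "2 * t \<le> (n - 1) * i - (real n - 3)"
    using assms(1) by (simp add: i_def t_def of_nat_diff algebra_simps)
  have i': "i' = 2 ^ (n - 1) + 1"
    by (simp add: i'_def num_independent_sets_star[OF assms(1)])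
  have "2 * t' = real ((n - 1) * 2 ^ (n - 1) + 2)"
    unfolding t'_def total_independent_size_star[OF assms(1), symmetric] by simp
  \<comment> \<open>The star attains equality in the bound just shown for \<open>t\<close>.\<close>
  then have t': "2 * t' = (n - 1) * i' - (real n - 3)"
    using assms(1) by (simp add: i' of_nat_diff algebra_simps)
  have "n + 1 \<le> num_independent_sets T" "num_independent_sets T \<le> 2 ^ (n - 1) + 1"
    using num_independent_sets_ge num_independent_sets_le[OF con] assms(3) by auto
  then have "real (n + 1) \<le> i" and le: "i \<le> i'"
    unfolding i_def i'_def num_independent_sets_star[OF assms(1)] by (simp_all only: of_nat_le_iff)
  then have ge: "real n + 1 \<le> i"
    by simp
  \<comment> \<open>For \<open>n < 3\<close> the first factor is negative, so the second has to
    vanish: there the lower and upper bounds on \<open>i\<close> coincide.\<close>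
  have "(real n - 3) * (i' - i) \<ge> 0"
  proof (cases "n \<ge> 3")
    case True
    then show ?thesis
      using le by simp
  next
    case False
    then have "n = 1 \<or> n = 2"
      using assms(1) by auto
    then have "i' = i"
      using ge le i' by auto
    then show ?thesis
      by simp
  qed
  have pos: "i > 0" "i' > 0"
    using ge le by auto
  have "2 * t * i' \<le> ((n - 1) * i - (real n - 3)) * i'"
    using t pos by (intro mult_right_mono) auto
  \<comment> \<open>The right side minus the left side is exactly
    \<open>(real n - 3) * (i' - i)\<close>.\<close>
  also have "\<dots> \<le> ((n - 1) * i' - (real n - 3)) * i"
    using \<open>(real n - 3) * (i' - i) \<ge> 0\<close> by (simp add: algebra_simps)
  finally have "t * i' \<le> t' * i"
    by (simp only: t'[symmetric])
  then have "t / i \<le> t' / i'"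
    using pos by (simp add: divide_simps mult.commute)
  then show ?thesis
    by (simp add: avi_def i_def t_def i'_def t'_def)
qed

end
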